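(* For any constants $c>0$ and $a\ge 1$, there exist a constant $C$ and a (random) hash function $h: U\to[n]$ generated by $O(\log n\log\log n)$ random bits such that for any set of $m=\log^a n\cdot n$ balls in $U$, with probability at least $1-n^{-c}$, the max-load of the $n$ bins in the 1-choice scheme with $h$ is at most $\frac{m}{n}\left(1 + C\sqrt{\log n}\cdot\sqrt{\frac{n}{m}}\right)$.
   Context: There are $n$ bins $[n]$, $n$ a power of 2, logarithms base 2, and $U$ is a universe of balls with $|U|=\mathrm{poly}(n)$. In the 1-choice scheme, each ball $x$ is placed in bin $h(x)$; the max-load is the maximum number of balls in any bin. *)

theory Defs
  imports "HOL-Probability.Probability" "HOL-Library.Landau_Symbols"
begin

text \<open>A random object is generated by \<open>r\<close> random bits if it is a (deterministic) function of a
  uniformly distributed bit string of length \<open>r\<close>.\<close>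

definition generated_by_bits :: "nat \<Rightarrow> 'a pmf \<Rightarrow> bool" where
  "generated_by_bits r X \<longleftrightarrow>
     (\<exists>g. X = map_pmf g (pmf_of_set {w :: bool list. length w = r}))"

definition random_hash_function :: "'u set \<Rightarrow> nat \<Rightarrow> ('u \<Rightarrow> nat) pmf \<Rightarrow> bool" where
  "random_hash_function U n H \<longleftrightarrow> (\<forall>h\<in>set_pmf H. h \<in> U \<rightarrow> {1..n})"

text \<open>In the 1-choice scheme each ball \<open>x \<in> S\<close> is placed in bin \<open>h x\<close>.\<close>

definition max_load :: "nat \<Rightarrow> ('u \<Rightarrow> nat) \<Rightarrow> 'u set \<Rightarrow> nat" where
  "max_load n h S = Max ((\<lambda>i. card {x \<in> S. h x = i}) ` {1..n})"

text \<open>The number of balls is meant to be \<open>(log n)\<^sup>a \<cdot> n\<close>, which need not be an integer; both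
  roundings are admitted, and for an integral value they coincide with it.\<close>

definition ball_counts :: "real \<Rightarrow> nat \<Rightarrow> nat set" where
  "ball_counts a n =
     (let v = log 2 (real n) powr a * real n in {nat \<lfloor>v\<rfloor>, nat \<lceil>v\<rceil>})"

end

theory Submission
  imports Defs
begin

text \<open>The hash function is drawn from a family of \<open>n\<^sup>M\<close> functions, so that \<open>M log n\<close> bits select it;
  the existence of a good family is shown by the probabilistic method. For a fixed set of balls, a
  Chernoff bound and a union bound over the bins show that a uniformly random function violates the
  load bound with probability at most \<open>n powr (- 2 * M)\<close>. Hence, if the \<open>n\<^sup>M\<close> functions are chosen independently, more
  than a fraction \<open>n powr (- c)\<close> of them violate it with probability less than \<open>2 powr (- |U|)\<close>, as soon as
  \<open>M\<close> is large compared with \<open>c\<close> and the degree of \<open>|U|\<close>, and one can afford a union bound over all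
  subsets of \<open>U\<close>.\<close>

text \<open>A Chernoff bound in counting form, with \<open>z\<close> the exponential of the usual parameter. It is applied
  both to the balls that fall into one bin and to the bad functions in a random family.\<close>

lemma card_PiE_many_hits_le:
  fixes I :: "'i set" and A :: "'b set" and p z \<theta> :: real
  assumes fin: "finite I" "finite A" and S: "S \<subseteq> I" and z: "z \<ge> 1"
    and p: "real (card {y \<in> A. P y}) \<le> p * real (card A)"
  shows "real (card {f \<in> I \<rightarrow>\<^sub>E A. \<theta> \<le> real (card {x \<in> S. P (f x)})})
           \<le> exp (p * (z - 1) * real (card S)) * z powr (- \<theta>) * real (card (I \<rightarrow>\<^sub>E A))"
proof -
  let ?g = "\<lambda>x y. if x \<in> S \<and> P y then z else 1"
  let ?B = "{f \<in> I \<rightarrow>\<^sub>E A. \<theta> \<le> real (card {x \<in> S. P (f x)})}"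
  have finS: "finite S" using S fin(1) finite_subset by blast
  have finP: "finite (I \<rightarrow>\<^sub>E A)" using fin by (simp add: finite_PiE)
  have weight: "(\<Prod>x\<in>I. ?g x (f x)) = z powr real (card {x \<in> S. P (f x)})" for f
  proof -
    have "(\<Prod>x\<in>I. ?g x (f x)) = (\<Prod>x\<in>{x \<in> S. P (f x)}. z)"
      using S fin by (intro prod.mono_neutral_cong_right) auto
    then show ?thesis using z by (simp add: powr_realpow)
  qed
  have factor: "(\<Sum>y\<in>A. ?g x y) \<le> real (card A) * (if x \<in> S then exp (p * (z - 1)) else 1)" for x
  proof (cases "x \<in> S")
    case True
    have "(\<Sum>y\<in>A. ?g x y) = (\<Sum>y\<in>A. 1 + (if P y then z - 1 else 0))"
      using True by (intro sum.cong) auto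
    also have "\<dots> = real (card A) + (z - 1) * real (card {y \<in> A. P y})"
      using fin by (simp add: sum.distrib sum.If_cases Int_def)
    also have "\<dots> \<le> real (card A) + (z - 1) * (p * real (card A))"
      using p z by (intro add_left_mono mult_left_mono) auto
    also have "\<dots> = real (card A) * (1 + p * (z - 1))" by (simp add: algebra_simps)
    also have "\<dots> \<le> real (card A) * exp (p * (z - 1))"
      by (intro mult_left_mono) auto
    finally show ?thesis using True by simp
  qed auto
  have "z powr \<theta> * real (card ?B) = (\<Sum>f\<in>?B. z powr \<theta>)" by simp
  \<comment> \<open>Markov's inequality in counting form: on \<open>?B\<close> the weight, which is
    \<open>z\<close> to the number of hits, is at least \<open>z powr \<theta>\<close>.\<close>
  also have "\<dots> \<le> (\<Sum>f\<in>?B. \<Prod>x\<in>I. ?g x (f x))"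
    unfolding weight using z by (intro sum_mono powr_mono) auto
  also have "\<dots> \<le> (\<Sum>f\<in>I \<rightarrow>\<^sub>E A. \<Prod>x\<in>I. ?g x (f x))"
    using z finP by (intro sum_mono2) (auto intro!: prod_nonneg)
  \<comment> \<open>Exchanging sum and product over the function space takes the place of
    independence of the values \<open>f x\<close>.\<close>
  also have "\<dots> = (\<Prod>x\<in>I. \<Sum>y\<in>A. ?g x y)"
    using fin by (simp add: prod_sum_PiE)
  also have "\<dots> \<le> (\<Prod>x\<in>I. real (card A) * (if x \<in> S then exp (p * (z - 1)) else 1))"
    using z by (intro prod_mono conjI factor sum_nonneg) auto
  also have "\<dots> = real (card (I \<rightarrow>\<^sub>E A)) * (\<Prod>x\<in>S. exp (p * (z - 1)))"
    using fin S by (simp add: prod.distrib card_PiE prod.If_cases Int_absorb1)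
  also have "(\<Prod>x\<in>S. exp (p * (z - 1))) = exp (p * (z - 1) * real (card S))"
    by (simp add: exp_of_nat_mult[symmetric] mult_ac)
  finally have le: "z powr (-\<theta>) * (z powr \<theta> * real (card ?B))
      \<le> z powr (-\<theta>) * (real (card (I \<rightarrow>\<^sub>E A)) * exp (p * (z - 1) * real (card S)))"
    by (intro mult_left_mono) auto
  have "z powr (-\<theta>) * (z powr \<theta> * real (card ?B)) = real (card ?B)"
    using z by (simp add: powr_minus)
  from le[unfolded this] show ?thesis by (simp add: mult_ac)
qed

text \<open>The allowed excess over the mean load is \<open>C\<close> times the geometric mean of
  that mean and \<open>log 2 n\<close>. As the mean is at least \<open>log 2 n\<close>, the Chernoff
  bound makes each bin overflow for at most a fraction \<open>n powr (1 - C)\<close> of the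
  functions, and the union over \<open>n\<close> bins costs one more factor
  \<open>n\<close>.\<close>

lemma card_max_load_gt_le:
  fixes C :: real
  assumes n: "n \<ge> 2" and U: "finite U" "S \<subseteq> U" and C: "C \<ge> 1"
    and m: "log 2 (real n) * real n \<le> real (card S)"
  defines "B \<equiv> real (card S) / real n *
     (1 + C * sqrt (log 2 (real n)) * sqrt (real n / real (card S)))"
  shows "real (card {h \<in> U \<rightarrow>\<^sub>E {1..n}. \<not> real (max_load n h S) \<le> B})
           \<le> real n powr (2 - C) * real (card (U \<rightarrow>\<^sub>E {1..n}))"
proof -
  define L where "L = log 2 (real n)"
  define \<mu> where "\<mu> = real (card S) / real n"
  \<comment> \<open>up to constants the optimal Chernoff parameter; \<open>\<mu> \<ge> L\<close> keeps it in the range \<open>exp \<eta> \<le> 1 + \<eta> + \<eta>\<^sup>2\<close>\<close>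
  define \<eta> where "\<eta> = sqrt (L / \<mu>)"
  let ?H = "U \<rightarrow>\<^sub>E {1..n}"
  let ?N = "real (card ?H)"
  have L: "L > 0" using n by (simp add: L_def)
  have \<mu>L: "\<mu> \<ge> L" using m n by (simp add: \<mu>_def L_def pos_le_divide_eq)
  have \<mu>: "\<mu> > 0" using L \<mu>L by simp
  have \<eta>: "0 \<le> \<eta>" "\<eta> \<le> 1" using L \<mu>L \<mu> by (auto simp: \<eta>_def)
  have \<eta>2: "\<mu> * \<eta>\<^sup>2 = L" using L \<mu> by (simp add: \<eta>_def)
  have B: "B = \<mu> + C * (sqrt L * sqrt \<mu>)"
  proof -
    have "real n / real (card S) = 1 / \<mu>" by (simp add: \<mu>_def)
    moreover have "\<mu> * sqrt (1 / \<mu>) = sqrt \<mu>"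
      using \<mu> by (simp add: real_sqrt_divide real_div_sqrt)
    ultimately show ?thesis
      unfolding B_def \<mu>_def[symmetric] L_def[symmetric] by (simp add: algebra_simps)
  qed
  have \<eta>B: "\<eta> * B = \<eta> * \<mu> + C * L"
    using \<mu> L by (simp add: B \<eta>_def real_sqrt_divide algebra_simps)
  have bin: "real (card {h \<in> ?H. B \<le> real (card {x \<in> S. h x = i})})
      \<le> real n powr (1 - C) * ?N" if i: "i \<in> {1..n}" for i
  proof -
    \<comment> \<open>A hit is a value equal to \<open>i\<close>, so the Chernoff lemma applies with
      \<open>p = 1 / n\<close> and \<open>z = exp \<eta>\<close>.\<close>
    have "{y \<in> {1..n}. y = i} = {i}" using i by auto
    then have "real (card {h \<in> ?H. B \<le> real (card {x \<in> S. h x = i})})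
        \<le> exp (1 / real n * (exp \<eta> - 1) * real (card S)) * exp \<eta> powr (- B) * ?N"
      using \<eta> n U by (intro card_PiE_many_hits_le) auto
    also have "1 / real n * (exp \<eta> - 1) * real (card S) = \<mu> * (exp \<eta> - 1)"
      by (simp add: \<mu>_def)
    also have "exp \<eta> powr (- B) = exp (- (\<eta> * B))" by (simp add: powr_def mult.commute)
    also have "exp (\<mu> * (exp \<eta> - 1)) * exp (- (\<eta> * B)) \<le> real n powr (1 - C)"
    proof -
      \<comment> \<open>The linear term \<open>\<mu> * \<eta>\<close> cancels against the one in
        \<open>\<eta> * B\<close>; the quadratic term contributes only \<open>L\<close>, against the
        gain \<open>C * L\<close>.\<close>
      have "\<mu> * (exp \<eta> - 1) \<le> \<mu> * (\<eta> + \<eta>\<^sup>2)"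
        using exp_bound[OF \<eta>] \<mu> by (intro mult_left_mono) auto
      then have "\<mu> * (exp \<eta> - 1) - \<eta> * B \<le> (1 - C) * L"
        using \<eta>2 \<eta>B by (simp add: algebra_simps)
      \<comment> \<open>The factor \<open>1 - C\<close> is not positive, so the binary logarithm may
        be replaced by the smaller natural one, which turns the exponential into a power of
        \<open>n\<close>.\<close>
      also have "\<dots> \<le> (1 - C) * ln (real n)"
      proof (rule mult_left_mono_neg)
        have "ln (real n) * ln 2 \<le> ln (real n) * 1"
          using n ln2_le_25_over_36 by (intro mult_left_mono) auto
        then show "ln (real n) \<le> L" by (simp add: L_def log_def pos_le_divide_eq)
      qed (use C in simp)
      finally show ?thesis using n by (simp add: powr_def exp_add[symmetric])
    qed
    finally show ?thesis by (simp add: mult_right_mono)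
  qed
  have sub: "{h \<in> ?H. \<not> real (max_load n h S) \<le> B}
      \<subseteq> (\<Union>i\<in>{1..n}. {h \<in> ?H. B \<le> real (card {x \<in> S. h x = i})})"
  proof
    fix h assume h: "h \<in> {h \<in> ?H. \<not> real (max_load n h S) \<le> B}"
    have "max_load n h S \<in> (\<lambda>i. card {x \<in> S. h x = i}) ` {1..n}"
      unfolding max_load_def using n by (intro Max_in) auto
    then obtain i where "i \<in> {1..n}" "max_load n h S = card {x \<in> S. h x = i}" by auto
    with h show "h \<in> (\<Union>i\<in>{1..n}. {h \<in> ?H. B \<le> real (card {x \<in> S. h x = i})})"
      by (intro UN_I[of i]) auto
  qed
  have "card {h \<in> ?H. \<not> real (max_load n h S) \<le> B}
      \<le> card (\<Union>i\<in>{1..n}. {h \<in> ?H. B \<le> real (card {x \<in> S. h x = i})})"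
    using U by (intro card_mono sub) (auto intro!: finite_PiE)
  also have "\<dots> \<le> (\<Sum>i\<in>{1..n}. card {h \<in> ?H. B \<le> real (card {x \<in> S. h x = i})})"
    by (rule card_UN_le) simp
  finally have "real (card {h \<in> ?H. \<not> real (max_load n h S) \<le> B})
      \<le> (\<Sum>i\<in>{1..n}. real (card {h \<in> ?H. B \<le> real (card {x \<in> S. h x = i})}))"
    unfolding of_nat_sum[symmetric] by (rule of_nat_mono)
  also have "\<dots> \<le> (\<Sum>i\<in>{1..n}. real n powr (1 - C) * ?N)"
    by (intro sum_mono bin)
  also have "\<dots> = real n powr (2 - C) * ?N"
    using n powr_add[of "real n" 1 "1 - C"] by simp
  finally show ?thesis .
qed

text \<open>A uniformly random \<open>g\<close> is a family of \<open>card W\<close> independent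
  samples from \<open>F\<close>. The Chernoff parameter \<open>z\<close> is \<open>card W\<close>
  itself: the condition on \<open>p\<close> then bounds the exponential factor by
  \<open>exp 1\<close>, so a fixed \<open>s\<close> has \<open>\<theta>\<close> or more bad samples
  with probability at most \<open>exp 1 * card W powr (- \<theta>)\<close>. The last assumption
  makes the union bound over \<open>\<S>\<close> strict.\<close>

lemma exists_sample_few_bad:
  fixes F :: "'b set" and W :: "'w set" and \<theta> p :: real
  assumes fin: "finite F" "F \<noteq> {}" "finite W" "W \<noteq> {}" "finite \<S>"
    and bad: "\<And>s. s \<in> \<S> \<Longrightarrow> real (card {y \<in> F. Bad s y}) \<le> p * real (card F)"
    and p: "0 \<le> p" "p * (real (card W))\<^sup>2 \<le> 1"
    and few: "real (card \<S>) * exp 1 < real (card W) powr \<theta>"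
  shows "\<exists>g \<in> W \<rightarrow>\<^sub>E F. \<forall>s\<in>\<S>. real (card {w \<in> W. Bad s (g w)}) < \<theta>"
proof -
  let ?R = "real (card W)" and ?G = "W \<rightarrow>\<^sub>E F"
  let ?X = "\<lambda>s. {g \<in> ?G. \<theta> \<le> real (card {w \<in> W. Bad s (g w)})}"
  have R: "?R \<ge> 1" using fin by (simp add: Suc_le_eq card_gt_0_iff)
  have finG: "finite ?G" using fin by (simp add: finite_PiE)
  have G: "card ?G > 0" using fin by (simp add: card_PiE card_gt_0_iff)
  have X: "real (card (?X s)) \<le> exp 1 * ?R powr (- \<theta>) * real (card ?G)" if "s \<in> \<S>" for s
  proof -
    have "real (card (?X s)) \<le> exp (p * (?R - 1) * ?R) * ?R powr (- \<theta>) * real (card ?G)"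
      using fin R bad[OF that] by (intro card_PiE_many_hits_le) auto
    also have "p * (?R - 1) * ?R \<le> p * ?R\<^sup>2"
      using p R by (simp add: power2_eq_square algebra_simps)
    then have "exp (p * (?R - 1) * ?R) \<le> exp 1" using p by simp
    then have "exp (p * (?R - 1) * ?R) * ?R powr (- \<theta>) * real (card ?G)
        \<le> exp 1 * ?R powr (- \<theta>) * real (card ?G)"
      by (intro mult_right_mono) auto
    finally show ?thesis .
  qed
  have "real (card (\<Union>s\<in>\<S>. ?X s)) \<le> real (\<Sum>s\<in>\<S>. card (?X s))"
    using fin by (intro of_nat_mono card_UN_le)
  also have "\<dots> \<le> (\<Sum>s\<in>\<S>. exp 1 * ?R powr (- \<theta>) * real (card ?G))"
    unfolding of_nat_sum by (intro sum_mono X)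
  also have "\<dots> = (real (card \<S>) * exp 1) * ?R powr (- \<theta>) * real (card ?G)" by simp
  also have "\<dots> < ?R powr \<theta> * ?R powr (- \<theta>) * real (card ?G)"
    using few R G by (intro mult_strict_right_mono) auto
  also have "\<dots> = real (card ?G)" using R by (simp add: powr_minus)
  finally have "(\<Union>s\<in>\<S>. ?X s) \<noteq> ?G" by auto
  then obtain g where "g \<in> ?G" "g \<notin> (\<Union>s\<in>\<S>. ?X s)" by blast
  then show ?thesis by force
qed

text \<open>As \<open>n\<close> is a power of two, \<open>log 2 n * n\<close> is an integer, so the
  lower bound survives rounding down.\<close>

lemma ball_counts_ge:
  assumes a: "a \<ge> 1" and n: "n = 2 ^ t" and m: "m \<in> ball_counts a n"
  shows "log 2 (real n) * real n \<le> real m"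
proof -
  define v where "v = log 2 (real n) powr a * real n"
  have log: "log 2 (real n) = real t" using n by (simp add: log_nat_power)
  have "real t powr 1 \<le> real t powr a" if "t > 0"
    using that a by (intro powr_mono) auto
  then have "real t \<le> real t powr a" by (cases "t = 0") auto
  then have "real (t * n) \<le> v" unfolding v_def log by (simp add: mult_right_mono)
  then have "int (t * n) \<le> \<lfloor>v\<rfloor>" by (simp add: le_floor_iff)
  moreover have "m = nat \<lfloor>v\<rfloor> \<or> m = nat \<lceil>v\<rceil>"
    using m by (auto simp: ball_counts_def v_def Let_def)
  moreover have "\<lfloor>v\<rfloor> \<le> \<lceil>v\<rceil>" by (rule floor_le_ceiling)
  ultimately have "t * n \<le> m" by (elim disjE) linarith+
  then have "real (t * n) \<le> real m" by (rule of_nat_mono)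
  then show ?thesis by (simp add: log)
qed

text \<open>The constants \<open>K\<close> and \<open>k\<close> express that the size of the
  universe is polynomial in \<open>n\<close>. \<open>C\<close> and \<open>r\<close> are fixed before
  \<open>n\<close> and \<open>U\<close>, whereas \<open>H\<close> may depend on both.\<close>

theorem theorem7p1:
  fixes c a K k :: real
  assumes "c > 0" and "a \<ge> 1"
  shows "\<exists>(C :: real) (r :: nat \<Rightarrow> nat).
     (\<lambda>n. real (r n)) \<in> O(\<lambda>n. log 2 (real n) * log 2 (log 2 (real n))) \<and>
     (\<forall>(n :: nat) (U :: 'u set).
        (\<exists>t :: nat. n = 2 ^ t) \<and> finite U \<and> real (card U) \<le> K * real n powr k \<longrightarrow>
        (\<exists>H :: ('u \<Rightarrow> nat) pmf.
           random_hash_function U n H \<and> generated_by_bits (r n) H \<and>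
           (\<forall>m \<in> ball_counts a n. \<forall>S \<subseteq> U. card S = m \<longrightarrow>
              measure_pmf.prob H
                {h. real (max_load n h S) \<le>
                      real m / real n * (1 + C * sqrt (log 2 (real n)) * sqrt (real n / real m))}
              \<ge> 1 - real n powr (- c))))"
proof -
  \<comment> \<open>For \<open>n \<ge> 2\<close>, \<open>card U \<le> n ^ d\<close>. The choice of
    \<open>M\<close> leaves \<open>n powr (M - c) \<ge> n ^ (d + 2)\<close>, and that of
    \<open>C\<close> makes \<open>n powr (2 - C)\<close> the inverse square of the family size
    \<open>n ^ M\<close>.\<close>
  define d where "d = nat \<lceil>\<bar>k\<bar>\<rceil> + nat \<lceil>\<bar>K\<bar>\<rceil>"
  define M where "M = nat \<lceil>c\<rceil> + d + 2"
  define C where "C = 2 * real M + 2"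
  define r where "r n = nat \<lfloor>real M * log 2 (real n)\<rfloor>" for n
  let ?good = "\<lambda>(n::nat) (S :: 'u set) h. real (max_load n h S) \<le>
      real (card S) / real n * (1 + C * sqrt (log 2 (real n)) * sqrt (real n / real (card S)))"
  have hash: "\<exists>H :: ('u \<Rightarrow> nat) pmf. random_hash_function U n H \<and> generated_by_bits (r n) H \<and>
      (\<forall>S\<subseteq>U. card S \<in> ball_counts a n \<longrightarrow>
        measure_pmf.prob H {h. ?good n S h} \<ge> 1 - real n powr (- c))"
    if n: "n = 2 ^ t" and U: "finite U" "real (card U) \<le> K * real n powr k"
    for n t and U :: "'u set"
  proof (cases "t = 0")
    case True
    \<comment> \<open>For \<open>n = 1\<close> the required probability is \<open>1 - 1 = 0\<close>,
      so a constant function will do.\<close>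
    let ?H = "map_pmf (\<lambda>_ _. 1) (pmf_of_set {w :: bool list. length w = r n}) :: ('u \<Rightarrow> nat) pmf"
    have "random_hash_function U n ?H" using n by (auto simp: random_hash_function_def)
    moreover have "generated_by_bits (r n) ?H" unfolding generated_by_bits_def by blast
    ultimately show ?thesis using n True by (intro exI[of _ ?H]) auto
  next
    case False
    define W where "W = {w :: bool list. length w = r n}"
    let ?R = "real (card W)" and ?F = "U \<rightarrow>\<^sub>E {1..n}"
    let ?\<S> = "{S. S \<subseteq> U \<and> card S \<in> ball_counts a n}"
    have n2: "n \<ge> 2" using False n by (metis One_nat_def Suc_leI self_le_power power_increasing
        neq0_conv numeral_2_eq_2 one_le_numeral power_one_right)
    have "log 2 (real n) = real t" using n by (simp add: log_nat_power)
    then have "r n = M * t" unfolding r_def by (simp flip: of_nat_mult)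
    then have cardW: "card W = n ^ M"
      using card_lists_length_eq[of "UNIV :: bool set" "r n"]
      by (simp add: W_def n power_mult[symmetric] mult.commute)
    have finW: "finite W" unfolding W_def
      using finite_lists_length_eq[of "UNIV :: bool set" "r n"] by simp
    have W0: "W \<noteq> {}" using cardW n by auto
    have finF: "finite ?F" "?F \<noteq> {}" using U n2 by (auto simp: finite_PiE PiE_eq_empty_iff)
    have fin\<S>: "finite ?\<S>" using U by simp
    \<comment> \<open>The summand 2 pays for the factor \<open>exp 1 < 4\<close> in the union bound
      over subsets of \<open>U\<close>.\<close>
    have sizeU: "real (card U) + 2 \<le> ?R * real n powr (- c)"
    proof -
      have "K \<le> real n ^ nat \<lceil>\<bar>K\<bar>\<rceil>"
      proof -
        have "K \<le> real (nat \<lceil>\<bar>K\<bar>\<rceil>)" by linarith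
        also have "\<dots> \<le> 2 ^ nat \<lceil>\<bar>K\<bar>\<rceil>" by (rule less_imp_le[OF of_nat_less_two_power])
        also have "\<dots> \<le> real n ^ nat \<lceil>\<bar>K\<bar>\<rceil>" using n2 by (intro power_mono) auto
        finally show ?thesis .
      qed
      moreover have "real n powr k \<le> real n ^ nat \<lceil>\<bar>k\<bar>\<rceil>"
      proof -
        have "real n powr k \<le> real n powr real (nat \<lceil>\<bar>k\<bar>\<rceil>)"
          using n2 by (intro powr_mono) linarith+
        also have "\<dots> = real n ^ nat \<lceil>\<bar>k\<bar>\<rceil>" using n2 by (intro powr_realpow) simp
        finally show ?thesis .
      qed
      ultimately have "K * real n powr k \<le> real n ^ nat \<lceil>\<bar>K\<bar>\<rceil> * real n ^ nat \<lceil>\<bar>k\<bar>\<rceil>"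
        by (intro mult_mono) auto
      then have Ud: "real (card U) \<le> real n ^ d"
        using U(2) by (simp add: d_def power_add mult.commute)
      have "1 \<le> real n ^ d" using n2 by simp
      moreover have "4 \<le> (real n)\<^sup>2" using n2 power_mono[of 2 "real n" 2] by simp
      then have "real n ^ d * 4 \<le> real n ^ d * (real n)\<^sup>2"
        by (intro mult_left_mono) auto
      ultimately have "real (card U) + 2 \<le> real n ^ (d + 2)"
        using Ud by (simp only: power_add)
      also have "\<dots> = real n powr real (d + 2)"
        using n2 by (intro powr_realpow[symmetric]) simp
      also have "\<dots> \<le> real n powr (real M - c)"
        using n2 by (intro powr_mono) (simp_all add: M_def, linarith)
      also have "\<dots> = ?R * real n powr (- c)"
        using n2 powr_add[of "real n" "real M" "- c"] by (simp add: cardW powr_realpow)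
      finally show ?thesis .
    qed
    \<comment> \<open>The threshold is the fraction \<open>n powr (- c)\<close> of all seeds
      \<open>w\<close>, which is the failure probability to be achieved.\<close>
    have "\<exists>g \<in> W \<rightarrow>\<^sub>E ?F. \<forall>S\<in>?\<S>. real (card {w \<in> W. \<not> ?good n S (g w)}) < ?R * real n powr (- c)"
    proof (rule exists_sample_few_bad[OF finF finW W0 fin\<S>])
      fix S assume "S \<in> ?\<S>"
      then show "real (card {h \<in> ?F. \<not> ?good n S h}) \<le> real n powr (2 - C) * real (card ?F)"
        using n n2 U assms by (intro card_max_load_gt_le ball_counts_ge) (auto simp: C_def)
    next
      have "?R\<^sup>2 = real n ^ (M * 2)" by (simp add: cardW power_mult)
      also have "\<dots> = real n powr real (M * 2)"
        using n2 by (intro powr_realpow[symmetric]) simp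
      also have "real n powr (2 - C) * \<dots> = 1"
        using n2 by (simp add: C_def flip: powr_add)
      finally show "real n powr (2 - C) * ?R\<^sup>2 \<le> 1" by simp
    next
      have "card ?\<S> \<le> card (Pow U)" using U by (intro card_mono) auto
      then have "real (card ?\<S>) \<le> 2 ^ card U" using U by (simp add: card_Pow flip: of_nat_le_iff)
      then have "real (card ?\<S>) * exp 1 \<le> 2 ^ card U * exp 1" by (intro mult_right_mono) auto
      also have "\<dots> < 2 ^ card U * 4" using exp_le by (intro mult_strict_left_mono) auto
      also have "\<dots> = 2 powr (real (card U) + 2)" by (simp add: powr_add powr_realpow)
      also have "\<dots> \<le> 2 powr (?R * real n powr (- c))" using sizeU by (intro powr_mono) auto
      \<comment> \<open>Even base 2 suffices for the union bound; the sampling lemma asks for base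
        \<open>?R\<close>, which is at least 2.\<close>
      also have "\<dots> \<le> ?R powr (?R * real n powr (- c))"
      proof (rule powr_mono2)
        have "real n \<le> real n ^ M" using n2 power_increasing[of 1 M "real n"] by (simp add: M_def)
        moreover have "?R = real n ^ M" by (simp add: cardW)
        ultimately show "2 \<le> ?R" using n2 by linarith
      qed auto
      finally show "real (card ?\<S>) * exp 1 < ?R powr (?R * real n powr (- c))" .
    qed auto
    then obtain g where g: "g \<in> W \<rightarrow>\<^sub>E ?F"
      and few: "\<And>S. S \<in> ?\<S> \<Longrightarrow> real (card {w \<in> W. \<not> ?good n S (g w)}) < ?R * real n powr (- c)"
      by blast
    let ?H = "map_pmf g (pmf_of_set W)"
    have "random_hash_function U n ?H"
      using g finW W0 by (auto simp: random_hash_function_def set_pmf_of_set dest!: PiE_mem)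
    moreover have "generated_by_bits (r n) ?H"
      unfolding generated_by_bits_def W_def by blast
    moreover have "measure_pmf.prob ?H {h. ?good n S h} \<ge> 1 - real n powr (- c)"
      if "S \<subseteq> U" "card S \<in> ball_counts a n" for S
    proof -
      have "W \<inter> {w. ?good n S (g w)} = W - {w \<in> W. \<not> ?good n S (g w)}" by auto
      then have "real (card (W \<inter> {w. ?good n S (g w)}))
          = ?R - real (card {w \<in> W. \<not> ?good n S (g w)})"
        using finW by (simp add: card_Diff_subset of_nat_diff card_mono)
      also have "\<dots> \<ge> ?R * (1 - real n powr (- c))"
        using few[of S] that by (simp add: algebra_simps)
      finally have "?R * (1 - real n powr (- c)) \<le> real (card (W \<inter> {w. ?good n S (g w)}))" .
      moreover have "?R > 0" using finW W0 by (simp add: card_gt_0_iff)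
      ultimately have "1 - real n powr (- c) \<le> real (card (W \<inter> {w. ?good n S (g w)})) / ?R"
        by (simp add: pos_le_divide_eq mult.commute)
      then show ?thesis
        using finW W0 by (simp add: measure_pmf_of_set vimage_def)
    qed
    ultimately show ?thesis by blast
  qed
  have bits: "(\<lambda>n. real (r n)) \<in> O(\<lambda>n. log 2 (real n) * log 2 (log 2 (real n)))"
  proof (rule bigoI[of _ "real M"])
    \<comment> \<open>From \<open>n = 4\<close> on, \<open>log 2 (log 2 n)\<close> is at least 1, so
      \<open>M * log 2 n\<close> is within the bound.\<close>
    show "\<forall>\<^sub>F n in sequentially. norm (real (r n))
        \<le> real M * norm (log 2 (real n) * log 2 (log 2 (real n)))"
      using eventually_ge_at_top[of 4]
    proof eventually_elim
      case (elim n)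
      have L: "2 \<le> log 2 (real n)" using elim by (simp add: le_log_iff powr_numeral)
      then have LL: "1 \<le> log 2 (log 2 (real n))" by (simp add: le_log_iff)
      have "0 \<le> real M * log 2 (real n)" using L by simp
      then have "real (r n) \<le> real M * log 2 (real n)" unfolding r_def by linarith
      also have "\<dots> \<le> real M * (log 2 (real n) * log 2 (log 2 (real n)))"
        using L LL by (intro mult_left_mono) (auto simp: mult_le_cancel_left1)
      finally show ?case using L LL by simp
    qed
  qed
  show ?thesis
  proof (intro exI[of _ C] exI[of _ r] conjI allI impI)
    fix n and U :: "'u set"
    assume "(\<exists>t :: nat. n = 2 ^ t) \<and> finite U \<and> real (card U) \<le> K * real n powr k"
    then obtain t where "n = 2 ^ t" "finite U" "real (card U) \<le> K * real n powr k" by blast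
    from hash[OF this] obtain H where "random_hash_function U n H" "generated_by_bits (r n) H"
      and "\<And>S. S \<subseteq> U \<Longrightarrow> card S \<in> ball_counts a n \<Longrightarrow>
        measure_pmf.prob H {h. ?good n S h} \<ge> 1 - real n powr (- c)"
      by blast
    then show "\<exists>H :: ('u \<Rightarrow> nat) pmf.
        random_hash_function U n H \<and> generated_by_bits (r n) H \<and>
        (\<forall>m \<in> ball_counts a n. \<forall>S \<subseteq> U. card S = m \<longrightarrow>
          measure_pmf.prob H
            {h. real (max_load n h S) \<le>
                  real m / real n * (1 + C * sqrt (log 2 (real n)) * sqrt (real n / real m))}
          \<ge> 1 - real n powr (- c))"
      by (intro exI[of _ H] conjI ballI allI impI) auto
  qed (rule bits)
qed

end
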